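(* Let $q$ be a prime power, let $AG_2(q)$ be an affine plane of order $q$, and let $\mathscr{F}(q)=Flag(AG_2(q))$ be its flag graph. Then $\mathscr{F}(q)$ is geodetic and has diameter $5$.
   Context: An affine plane of order $q$ is an incidence structure of points and lines in which any two distinct points lie on a unique common line; for every point $p$ not on a line $L$ there is a unique line through $p$ disjoint from $L$; there are three non-collinear points; and every line has exactly $q$ points. It then has $q^2$ points and $q^2+q$ lines, and every point lies on $q+1$ lines. For an incidence structure $\mathcal{S}=(P,\mathcal{L},\mathcal{I})$ with point set $P$, line set $\mathcal{L}$ and incidence relation $\mathcal{I}\subset P\times\mathcal{L}$, elements of $\mathcal{I}$ are called flags. The flag graph $Flag(\mathcal{S})$ is the simple undirected graph with vertex set $P\sqcup\mathcal{I}$ and two kinds of edges: each point $p$ is adjacent to each flag $(p,L)\in\mathcal{I}$; and $(p,L)$ is adjacent to $(p',L)$ for every two distinct points $p,p'$ of the same line $L$. A graph is geodetic if between any two of its vertices there exists a unique shortest path. *)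

theory Defs
  imports "Graph_Theory.Graph_Theory" "HOL-Number_Theory.Prime_Powers"
begin

record ('p, 'l) incidence_system =
  points :: "'p set"
  lines :: "'l set"
  flags :: "('p \<times> 'l) set"

locale incidence_structure =
  fixes S :: "('p, 'l) incidence_system"
  assumes flags_subset: "flags S \<subseteq> points S \<times> lines S"

text \<open>The three points in \<open>non_collinear\<close> have to be required to be distinct: otherwise a
  single point without lines would satisfy all the axioms, for every \<open>q\<close>.\<close>

locale affine_plane = incidence_structure S
  for S :: "('p, 'l) incidence_system" +
  fixes q :: nat
  assumes joining_line:
      "\<lbrakk>p \<in> points S; p' \<in> points S; p \<noteq> p'\<rbrakk>
        \<Longrightarrow> \<exists>!L. L \<in> lines S \<and> (p, L) \<in> flags S \<and> (p', L) \<in> flags S"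
    and parallel_line:
      "\<lbrakk>p \<in> points S; L \<in> lines S; (p, L) \<notin> flags S\<rbrakk>
        \<Longrightarrow> \<exists>!M. M \<in> lines S \<and> (p, M) \<in> flags S
                 \<and> {x \<in> points S. (x, M) \<in> flags S} \<inter> {x \<in> points S. (x, L) \<in> flags S} = {}"
    and non_collinear:
      "\<exists>a\<in>points S. \<exists>b\<in>points S. \<exists>c\<in>points S. a \<noteq> b \<and> a \<noteq> c \<and> b \<noteq> c
         \<and> \<not> (\<exists>L\<in>lines S. (a, L) \<in> flags S \<and> (b, L) \<in> flags S \<and> (c, L) \<in> flags S)"
    and card_line: "L \<in> lines S \<Longrightarrow> card {x \<in> points S. (x, L) \<in> flags S} = q"

text \<open>An undirected simple graph is a digraph without loops and parallel arcs whose arc relation is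
  symmetric (\<open>pair_bidirected_digraph\<close>); an edge is represented by its two orientations.\<close>

definition flag_graph :: "('p, 'l) incidence_system \<Rightarrow> ('p + 'p \<times> 'l) pair_pre_digraph" where
  "flag_graph S =
    \<lparr> pverts = points S <+> flags S,
      parcs = {(Inl p, Inr (p, L)) | p L. (p, L) \<in> flags S}
            \<union> {(Inr (p, L), Inl p) | p L. (p, L) \<in> flags S}
            \<union> {(Inr (p, L), Inr (p', L)) | p p' L.
                 (p, L) \<in> flags S \<and> (p', L) \<in> flags S \<and> p \<noteq> p'} \<rparr>"

lemma (in incidence_structure) pair_bidirected_digraph_flag_graph:
  "pair_bidirected_digraph (flag_graph S)"
  by unfold_locales
    (use flags_subset in \<open>auto simp: flag_graph_def symmetric_def intro!: symI\<close>)

text \<open>The number of edges of a shortest path, which is \<open>\<infinity>\<close> if there is no path.\<close>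

definition graph_dist :: "'a pair_pre_digraph \<Rightarrow> 'a \<Rightarrow> 'a \<Rightarrow> ereal" where
  "graph_dist G u v = wf_digraph.\<mu> (with_proj G) (\<lambda>_. 1) u v"

definition shortest_path :: "'a pair_pre_digraph \<Rightarrow> 'a \<Rightarrow> ('a \<times> 'a) awalk \<Rightarrow> 'a \<Rightarrow> bool" where
  "shortest_path G u p v \<longleftrightarrow>
     pre_digraph.apath (with_proj G) u p v \<and> ereal (real (length p)) = graph_dist G u v"

definition geodetic :: "'a pair_pre_digraph \<Rightarrow> bool" where
  "geodetic G \<longleftrightarrow> (\<forall>u\<in>pverts G. \<forall>v\<in>pverts G. \<exists>!p. shortest_path G u p v)"

definition graph_diameter :: "'a pair_pre_digraph \<Rightarrow> ereal" where
  "graph_diameter G = (SUP u\<in>pverts G. SUP v\<in>pverts G. graph_dist G u v)"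

text \<open>\<open>wf_digraph.\<mu>\<close> can only be unfolded for well-formed digraphs; this confirms that the distance
  is the least length of a walk.\<close>

lemma (in pair_wf_digraph) graph_dist_eq_INF_length:
  "graph_dist G u v = (INF p\<in>{p. awalk u p v}. ereal (real (length p)))"
proof -
  have "awalk_cost (\<lambda>_. 1) p = real (length p)" for p :: "('a \<times> 'a) awalk"
    by (induction p) auto
  then show ?thesis
    by (simp add: graph_dist_def \<mu>_def)
qed

end

theory Submission
  imports Defs
begin

text \<open>The distance in the flag graph can be written down by cases (\<open>flag_dist\<close>), and everything
  follows from checking one local property of this formula.

  Suppose that for a fixed target \<open>v\<close> a function \<open>\<delta>\<close> vanishes at \<open>v\<close>, drops by at most one along every
  arc, and at each vertex other than \<open>v\<close> drops by exactly one along \<^emph>\<open>exactly one\<close> arc. The first two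
  properties make \<open>\<delta>\<close> a lower bound for the length of a walk to \<open>v\<close>; following the descending arcs
  attains the bound, so \<open>\<delta>\<close> is the distance to \<open>v\<close>. A shortest path has to descend at every step, so
  it has no choice anywhere, and shortest paths are unique (locale \<open>unique_descent\<close>).

  In the flag graph a walk alternates between travelling inside the clique of a line and changing the
  line at a point. Uniqueness of the descending arc then comes down to two facts: two points
  lie on exactly one line, and consequently two lines meet in at most one point
  (\<open>flag_dist_unique_descent\<close>). These hold in every linear space.

  The formula never exceeds 5, and takes the value 5 exactly for two flags on
  disjoint lines. An affine plane has such flags because it has parallel lines.\<close>

section \<open>Distance functions with unique descent\<close>

locale unique_descent = pair_wf_digraph G for G :: "'a pair_pre_digraph" +
  fixes v :: 'a and \<delta> :: "'a \<Rightarrow> nat"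
  assumes target: "v \<in> pverts G" "\<delta> v = 0"
    and drop_le_1: "(u, w) \<in> parcs G \<Longrightarrow> \<delta> u \<le> Suc (\<delta> w)"
    and descent: "\<lbrakk>u \<in> pverts G; u \<noteq> v\<rbrakk> \<Longrightarrow> \<exists>!w. (u, w) \<in> parcs G \<and> \<delta> u = Suc (\<delta> w)"
begin

lemma le_length_awalk: "awalk u p v \<Longrightarrow> \<delta> u \<le> length p"
proof (induction p arbitrary: u)
  case Nil
  then show ?case by (simp add: awalk_Nil_iff target)
next
  case (Cons e p)
  then have "\<delta> (snd e) \<le> length p" and "(u, snd e) \<in> parcs G"
    by (auto simp: awalk_Cons_iff)
  with drop_le_1[of u "snd e"] show ?case by simp
qed

text \<open>The bound on the values of \<open>\<delta>\<close> along the path keeps the vertices distinct when an arc is put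
  in front.\<close>

lemma ex_descending_apath:
  assumes "u \<in> pverts G"
  shows "\<exists>p. apath u p v \<and> length p = \<delta> u \<and> (\<forall>x\<in>set (awalk_verts u p). \<delta> x \<le> \<delta> u)"
  using assms
proof (induction "\<delta> u" arbitrary: u)
  case 0
  then have "u = v" using descent[of u] by auto
  then show ?case using target by (intro exI[of _ "[]"]) (simp add: apath_Nil_iff)
next
  case (Suc n)
  then have "u \<noteq> v" using target by auto
  then obtain w where w: "(u, w) \<in> parcs G" "\<delta> u = Suc (\<delta> w)"
    using descent Suc.prems by blast
  with Suc.hyps obtain p where p: "apath w p v" "length p = \<delta> w"
    "\<forall>x\<in>set (awalk_verts w p). \<delta> x \<le> \<delta> w"
    using in_arcsD2[OF w(1)] by (metis Suc_inject)
  then have "u \<notin> set (awalk_verts w p)" using w(2) by force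
  with p w show ?case
    by (intro exI[of _ "(u, w) # p"]) (auto simp: apath_Cons_iff)
qed

text \<open>A walk as short as \<open>\<delta>\<close> permits has to descend at every arc, since a step that does not would
  leave too much distance for the rest.\<close>

lemma tight_awalk_unique:
  "\<lbrakk>awalk u p v; length p = \<delta> u; awalk u p' v; length p' = \<delta> u\<rbrakk> \<Longrightarrow> p = p'"
proof (induction p arbitrary: u p')
  case Nil
  then show ?case by simp
next
  case (Cons e p)
  then obtain e' r where p': "p' = e' # r" by (cases p') auto
  have tight: "(u, snd a) \<in> parcs G \<and> \<delta> u = Suc (\<delta> (snd a)) \<and> a = (u, snd a)
      \<and> awalk (snd a) s v \<and> length s = \<delta> (snd a)"
    if "awalk u (a # s) v" "length (a # s) = \<delta> u" for a s
  proof -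
    have arc: "(u, snd a) \<in> parcs G" "a = (u, snd a)" "awalk (snd a) s v"
      using that(1) by (auto simp: awalk_Cons_iff)
    then show ?thesis
      using that(2) le_length_awalk[OF arc(3)] drop_le_1[OF arc(1)] by auto
  qed
  note e = tight[OF Cons.prems(1,2)] and e' = tight[OF Cons.prems(3,4)[unfolded p']]
  have "u \<noteq> v" using e target by auto
  moreover have "u \<in> pverts G" using e in_arcsD1 by blast
  ultimately have "snd e = snd e'" using descent e e' by blast
  with e e' Cons.IH[of "snd e" r] p' show ?case by metis
qed

lemma graph_dist_eq:
  assumes "u \<in> pverts G"
  shows "graph_dist G u v = ereal (real (\<delta> u))"
proof -
  obtain p where "apath u p v" "length p = \<delta> u"
    using ex_descending_apath[OF assms] by blast
  then have "p \<in> {p. awalk u p v}" "length p = \<delta> u" by (auto simp: apath_def)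
  then show ?thesis
    unfolding graph_dist_eq_INF_length
    by (intro antisym INF_greatest) (auto intro: INF_lower2 simp: le_length_awalk)
qed

lemma ex1_shortest_path:
  assumes "u \<in> pverts G"
  shows "\<exists>!p. shortest_path G u p v"
proof -
  have iff: "shortest_path G u p v \<longleftrightarrow> apath u p v \<and> length p = \<delta> u" for p
    by (simp add: shortest_path_def graph_dist_eq[OF assms])
  show ?thesis
    unfolding iff using ex_descending_apath[OF assms] tight_awalk_unique
    by (metis apath_def)
qed

end

section \<open>The distance in the flag graph of a linear space\<close>

locale linear_space = incidence_structure S
  for S :: "('p, 'l) incidence_system" +
  assumes ex1_joining_line:
    "\<lbrakk>p \<in> points S; p' \<in> points S; p \<noteq> p'\<rbrakk>
      \<Longrightarrow> \<exists>!L. L \<in> lines S \<and> (p, L) \<in> flags S \<and> (p', L) \<in> flags S"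

text \<open>The values for two flags on different lines are the lengths of the walks, in order of preference,
  that change the line at the common point \<open>p = p'\<close>, at \<open>p\<close> or \<open>p'\<close>, at a third point, or twice: at
  \<open>p\<close> to the line that joins \<open>p\<close> and \<open>p'\<close>, and again at \<open>p'\<close>.\<close>

fun flag_dist ::
  "('p, 'l) incidence_system \<Rightarrow> 'p + 'p \<times> 'l \<Rightarrow> 'p + 'p \<times> 'l \<Rightarrow> nat" where
  "flag_dist S (Inl p) (Inl p') = (if p = p' then 0 else 3)"
| "flag_dist S (Inl p) (Inr (p', L')) =
    (if p = p' then 1 else if (p, L') \<in> flags S then 2 else 4)"
| "flag_dist S (Inr (p, L)) (Inl p') =
    (if p = p' then 1 else if (p', L) \<in> flags S then 2 else 4)"
| "flag_dist S (Inr (p, L)) (Inr (p', L')) =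
    (if L = L' then (if p = p' then 0 else 1)
     else if p = p' then 2
     else if (p, L') \<in> flags S \<or> (p', L) \<in> flags S then 3
     else if \<exists>x. (x, L) \<in> flags S \<and> (x, L') \<in> flags S then 4
     else 5)"

lemma flag_dist_le_5: "flag_dist S u v \<le> 5"
  by (cases "(S, u, v)" rule: flag_dist.cases) auto

lemma pverts_flag_graph [simp]:
  "Inl p \<in> pverts (flag_graph S) \<longleftrightarrow> p \<in> points S"
  "Inr f \<in> pverts (flag_graph S) \<longleftrightarrow> f \<in> flags S"
  by (auto simp: flag_graph_def)

lemma parcs_flag_graph:
  "(Inl p, w) \<in> parcs (flag_graph S) \<longleftrightarrow> (\<exists>L. w = Inr (p, L) \<and> (p, L) \<in> flags S)"
  "(Inr (p, L), w) \<in> parcs (flag_graph S) \<longleftrightarrow>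
    (p, L) \<in> flags S \<and> (w = Inl p \<or> (\<exists>x. w = Inr (x, L) \<and> (x, L) \<in> flags S \<and> x \<noteq> p))"
  by (auto simp: flag_graph_def)

context linear_space
begin

lemma flag_in: "(p, L) \<in> flags S \<Longrightarrow> p \<in> points S \<and> L \<in> lines S"
  using flags_subset by auto

lemma joining_flags:
  assumes "p \<in> points S" "p' \<in> points S" "p \<noteq> p'"
  obtains L where "(p, L) \<in> flags S" "(p', L) \<in> flags S"
  using ex1_joining_line[OF assms] by blast

lemma common_points_imp_eq_line:
  "\<lbrakk>(p, L) \<in> flags S; (p', L) \<in> flags S; (p, M) \<in> flags S; (p', M) \<in> flags S; p \<noteq> p'\<rbrakk> \<Longrightarrow> L = M"
  using ex1_joining_line flag_in by metis

lemma flag_dist_drop_le_1: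
  assumes "(u, w) \<in> parcs (flag_graph S)" "v \<in> pverts (flag_graph S)"
  shows "flag_dist S u v \<le> Suc (flag_dist S w v)"
  using assms
  by (cases "(S, u, v)" rule: flag_dist.cases)
     (auto simp: parcs_flag_graph)

text \<open>From a point, the arc to follow leads to the flag on the line of \<open>v\<close> if the point lies on that
  line, and otherwise to the flag on the joining line with the point of \<open>v\<close>. If \<open>u\<close> is a flag
  \<open>(p, L)\<close>, it stays on \<open>L\<close> when \<open>L\<close> contains a better point than \<open>p\<close> for reaching \<open>v\<close>, and leads to
  \<open>p\<close> otherwise. Where several flags could compete, uniqueness of the joining line, or of the point where
  two lines meet, singles one out.\<close>

lemma flag_dist_unique_descent:
  assumes u: "u \<in> pverts (flag_graph S)" and v: "v \<in> pverts (flag_graph S)" and "u \<noteq> v"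
  shows "\<exists>!w. (u, w) \<in> parcs (flag_graph S) \<and> flag_dist S u v = Suc (flag_dist S w v)"
proof (cases "(S, u, v)" rule: flag_dist.cases)
  case (1 _ p p')
  with assms obtain L where L: "(p, L) \<in> flags S" "(p', L) \<in> flags S" "p \<noteq> p'"
    using joining_flags[of p p'] by auto
  then have "(p', M) \<in> flags S \<longleftrightarrow> M = L" if "(p, M) \<in> flags S" for M
    using that common_points_imp_eq_line by metis
  with 1 L show ?thesis
    by (intro ex1I[of _ "Inr (p, L)"]) (auto simp: parcs_flag_graph split: if_splits)
next
  case (2 _ p p' L')
  with assms have f: "p \<in> points S" "(p', L') \<in> flags S" by auto
  show ?thesis
  proof (cases "(p, L') \<in> flags S")
    case True
    with 2 f show ?thesis
      by (intro ex1I[of _ "Inr (p, L')"]) (auto simp: parcs_flag_graph split: if_splits)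
  next
    case False
    with f obtain L where L: "(p, L) \<in> flags S" "(p', L) \<in> flags S" "p \<noteq> p'"
      using joining_flags[of p p'] flag_in by metis
    then have "(p', M) \<in> flags S \<longleftrightarrow> M = L" if "(p, M) \<in> flags S" for M
      using that common_points_imp_eq_line by metis
    with 2 f False L show ?thesis
      by (intro ex1I[of _ "Inr (p, L)"]) (auto simp: parcs_flag_graph split: if_splits)
  qed
next
  case (3 _ p L p')
  with assms have f: "(p, L) \<in> flags S" by auto
  show ?thesis
  proof (cases "p \<noteq> p' \<and> (p', L) \<in> flags S")
    case True
    with 3 f show ?thesis
      by (intro ex1I[of _ "Inr (p', L)"]) (auto simp: parcs_flag_graph split: if_splits)
  next
    case False
    with 3 f show ?thesis
      by (intro ex1I[of _ "Inl p"]) (auto simp: parcs_flag_graph split: if_splits)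
  qed
next
  case (4 _ p L p' L')
  with assms have f: "(p, L) \<in> flags S" "(p', L') \<in> flags S" "(p, L) \<noteq> (p', L')" by auto
  consider
      (towards) y where "(y, L) \<in> flags S" "(y, L') \<in> flags S" "p \<noteq> y" "L = L' \<longrightarrow> y = p'"
        "L \<noteq> L' \<longrightarrow> (p, L') \<notin> flags S"
    | (on_target_line) "L \<noteq> L'" "(p, L') \<in> flags S"
    | (disjoint) "L \<noteq> L'" "\<And>x. (x, L) \<in> flags S \<Longrightarrow> (x, L') \<notin> flags S"
    using f by (cases "L = L'") auto
  then show ?thesis
  proof cases
    case towards
    \<comment> \<open>If the lines agree, then \<open>y = p'\<close> is the target; otherwise the walk has to stay on \<open>L\<close> until
      the point \<open>y\<close> where it can change to \<open>L'\<close>.\<close>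
    then have "(x, L') \<in> flags S \<longleftrightarrow> x = y" if "(x, L) \<in> flags S" "L \<noteq> L'" for x
      using that common_points_imp_eq_line by metis
    with 4 f towards show ?thesis
      by (intro ex1I[of _ "Inr (y, L)"]) (auto simp: parcs_flag_graph split: if_splits)
  next
    case on_target_line
    then have "(x, L') \<in> flags S \<longleftrightarrow> x = p" if "(x, L) \<in> flags S" for x
      using that f common_points_imp_eq_line by metis
    with 4 f on_target_line show ?thesis
      by (intro ex1I[of _ "Inl p"]) (auto simp: parcs_flag_graph split: if_splits)
  next
    case disjoint
    \<comment> \<open>Moving along \<open>L\<close> brings nothing, since none of its points lies on \<open>L'\<close>. The shortest walk goes
      through \<open>p\<close> to the line that joins \<open>p\<close> and \<open>p'\<close>.\<close>
    with 4 f have "p \<noteq> p'" "(p', L) \<notin> flags S" by auto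
    with 4 f disjoint show ?thesis
      by (intro ex1I[of _ "Inl p"]) (auto simp: parcs_flag_graph split: if_splits)
  qed
qed

lemma unique_descent_flag_dist:
  assumes "v \<in> pverts (flag_graph S)"
  shows "unique_descent (flag_graph S) v (\<lambda>u. flag_dist S u v)"
proof -
  interpret pair_bidirected_digraph "flag_graph S" by (rule pair_bidirected_digraph_flag_graph)
  have "flag_dist S v v = 0" by (cases v) auto
  then show ?thesis
    by unfold_locales (use assms flag_dist_drop_le_1 flag_dist_unique_descent in auto)
qed

lemma graph_dist_flag_graph:
  assumes "u \<in> pverts (flag_graph S)" "v \<in> pverts (flag_graph S)"
  shows "graph_dist (flag_graph S) u v = ereal (real (flag_dist S u v))"
  using unique_descent.graph_dist_eq[OF unique_descent_flag_dist] assms by blast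

theorem geodetic_flag_graph: "geodetic (flag_graph S)"
  unfolding geodetic_def
  using unique_descent.ex1_shortest_path[OF unique_descent_flag_dist] by blast

end

section \<open>Affine planes\<close>

sublocale affine_plane \<subseteq> linear_space
  using joining_line by unfold_locales

lemma (in affine_plane) ex_flags_at_distance_5:
  "\<exists>u\<in>pverts (flag_graph S). \<exists>v\<in>pverts (flag_graph S). flag_dist S u v = 5"
proof -
  obtain a b c where abc: "a \<in> points S" "b \<in> points S" "c \<in> points S" "a \<noteq> b"
      "\<not> (\<exists>L\<in>lines S. (a, L) \<in> flags S \<and> (b, L) \<in> flags S \<and> (c, L) \<in> flags S)"
    using non_collinear by blast
  then obtain L where L: "(a, L) \<in> flags S" "(c, L) \<notin> flags S" "L \<in> lines S"
    using joining_flags[of a b] flag_in by metis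
  then obtain M where M: "(c, M) \<in> flags S"
      "{x \<in> points S. (x, M) \<in> flags S} \<inter> {x \<in> points S. (x, L) \<in> flags S} = {}"
    using parallel_line abc by blast
  then have "\<not> (\<exists>x. (x, L) \<in> flags S \<and> (x, M) \<in> flags S)"
    using flag_in by blast
  with L M have "flag_dist S (Inr (a, L)) (Inr (c, M)) = 5" by auto
  moreover have "Inr (a, L) \<in> pverts (flag_graph S)" "Inr (c, M) \<in> pverts (flag_graph S)"
    using L M by simp_all
  ultimately show ?thesis by blast
qed

theorem (in affine_plane) graph_diameter_flag_graph: "graph_diameter (flag_graph S) = 5"
proof (rule antisym)
  show "graph_diameter (flag_graph S) \<le> 5"
    unfolding graph_diameter_def
  proof (intro SUP_least)
    fix u v assume "u \<in> pverts (flag_graph S)" "v \<in> pverts (flag_graph S)"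
    then show "graph_dist (flag_graph S) u v \<le> 5"
      using flag_dist_le_5[of S u v] by (simp add: graph_dist_flag_graph)
  qed
next
  obtain u v where uv: "u \<in> pverts (flag_graph S)" "v \<in> pverts (flag_graph S)"
      "flag_dist S u v = 5"
    using ex_flags_at_distance_5 by blast
  then have "5 \<le> graph_dist (flag_graph S) u v" by (simp add: graph_dist_flag_graph)
  with uv show "5 \<le> graph_diameter (flag_graph S)"
    unfolding graph_diameter_def by (meson SUP_upper2)
qed

theorem theorem3p3:
  fixes q :: nat and S :: "('p, 'l) incidence_system"
  assumes "primepow q"
    and "affine_plane S q"
  shows "geodetic (flag_graph S) \<and> graph_diameter (flag_graph S) = 5"
proof -
  interpret affine_plane S q by (rule assms(2))
  show ?thesis using geodetic_flag_graph graph_diameter_flag_graph by blast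
qed

end
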